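(* Let $G=(A\cup B,E)$ with $|A|=|B|=n$, where each agent has a strict partial order over her neighbors, and let $F\subseteq E$ be a set of forbidden edges. Algorithm 2 (described in the context) outputs a popular assignment $M$ of $G$ with $M\cap F=\emptyset$, if such an assignment exists in $G$.
   Context: For $\ell:B\to\mathbb{N}$ and $a\in A$, $\ell^*(a)=\max_{b\in\mathsf{Nbr}(a)}\ell(b)$; $G_\ell=(A\cup B,E_\ell)$ contains $(a,b)\in E$ iff (i) $\ell(b)=\ell^*(a)$ and no neighbor $b'$ of $a$ with $\ell(b')=\ell^*(a)$ has $b'\succ_ab$; or (ii) $\ell(b)=\ell^*(a)-1$, $b\succ_ab'$ for all neighbors $b'$ of $a$ with $\ell(b')=\ell^*(a)$, and no neighbor $b''$ with $\ell(b'')=\ell^*(a)-1$ has $b''\succ_ab$. Algorithm 2: set $\ell(b)=0$ for all $b\in B$; while $\ell(b)<n$ for all $b\in B$: construct $G_\ell$ and compute a maximum matching $M$ in $G_\ell-F$ (edge set $E_\ell\setminus F$); if $M$ is perfect, return $M$; otherwise increase $\ell(b)$ by 1 for every $b\in B$ unmatched in $M$. If the loop ends, report that no popular assignment avoiding $F$ exists. Popularity: agent $a$ prefers matching $M$ to $N$ if matched in $M$ and either unmatched in $N$ or $M(a)\succ_aN(a)$; $\Delta(M,N)$ is the number preferring $M$ minus the number preferring $N$; a popular assignment is a perfect matching $M$ with $\Delta(M,N)\ge0$ for all perfect matchings $N$ of $G$. *)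

theory Defs
  imports Main
begin

text \<open>
  A bipartite graph has agents in \<open>A :: 'a set\<close>, objects in \<open>B :: 'b set\<close> and edges
  \<open>E \<subseteq> A \<times> B\<close>; the two sides are disjoint because they have different types.
  Throughout, \<open>P a b b'\<close> reads ``agent \<open>a\<close> strictly prefers \<open>b\<close> to \<open>b'\<close>''.
\<close>

definition Nbr :: "('a \<times> 'b) set \<Rightarrow> 'a \<Rightarrow> 'b set" where
  "Nbr E a = {b. (a, b) \<in> E}"

definition matching :: "('a \<times> 'b) set \<Rightarrow> ('a \<times> 'b) set \<Rightarrow> bool" where
  "matching H M \<longleftrightarrow> M \<subseteq> H \<and>
     (\<forall>a b b'. (a, b) \<in> M \<longrightarrow> (a, b') \<in> M \<longrightarrow> b = b') \<and>
     (\<forall>a a' b. (a, b) \<in> M \<longrightarrow> (a', b) \<in> M \<longrightarrow> a = a')"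

definition maximum_matching :: "('a \<times> 'b) set \<Rightarrow> ('a \<times> 'b) set \<Rightarrow> bool" where
  "maximum_matching H M \<longleftrightarrow> matching H M \<and> (\<forall>N. matching H N \<longrightarrow> card N \<le> card M)"

definition perfect_matching ::
    "'a set \<Rightarrow> 'b set \<Rightarrow> ('a \<times> 'b) set \<Rightarrow> ('a \<times> 'b) set \<Rightarrow> bool" where
  "perfect_matching A B H M \<longleftrightarrow> matching H M \<and>
     (\<forall>a\<in>A. \<exists>b. (a, b) \<in> M) \<and> (\<forall>b\<in>B. \<exists>a. (a, b) \<in> M)"


definition partner :: "('a \<times> 'b) set \<Rightarrow> 'a \<Rightarrow> 'b" where
  "partner M a = (THE b. (a, b) \<in> M)"

definition prefers_matching ::
    "('a \<Rightarrow> 'b \<Rightarrow> 'b \<Rightarrow> bool) \<Rightarrow> 'a \<Rightarrow> ('a \<times> 'b) set \<Rightarrow> ('a \<times> 'b) set \<Rightarrow> bool" where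
  "prefers_matching P a M N \<longleftrightarrow> (\<exists>b. (a, b) \<in> M) \<and>
     ((\<nexists>b. (a, b) \<in> N) \<or> P a (partner M a) (partner N a))"

definition Delta ::
    "'a set \<Rightarrow> ('a \<Rightarrow> 'b \<Rightarrow> 'b \<Rightarrow> bool) \<Rightarrow> ('a \<times> 'b) set \<Rightarrow> ('a \<times> 'b) set \<Rightarrow> int" where
  "Delta A P M N =
     int (card {a \<in> A. prefers_matching P a M N}) - int (card {a \<in> A. prefers_matching P a N M})"

definition popular_assignment ::
    "'a set \<Rightarrow> 'b set \<Rightarrow> ('a \<times> 'b) set \<Rightarrow> ('a \<Rightarrow> 'b \<Rightarrow> 'b \<Rightarrow> bool) \<Rightarrow> ('a \<times> 'b) set \<Rightarrow> bool" where
  "popular_assignment A B E P M \<longleftrightarrow> perfect_matching A B E M \<and>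
     (\<forall>N. perfect_matching A B E N \<longrightarrow> Delta A P M N \<ge> 0)"


text \<open>
  \<open>max_level E l a\<close> is unspecified when \<open>a\<close> has no neighbour, but it is only used
  for agents incident to an edge.
\<close>

definition max_level :: "('a \<times> 'b) set \<Rightarrow> ('b \<Rightarrow> nat) \<Rightarrow> 'a \<Rightarrow> nat" where
  "max_level E l a = Max (l ` Nbr E a)"

text \<open>
  The condition \<open>l b = max_level E l a - 1\<close> is written additively, since subtraction on
  \<^typ>\<open>nat\<close> would make it true for \<open>l b = max_level E l a = 0\<close>.
\<close>

definition level_edges ::
    "('a \<times> 'b) set \<Rightarrow> ('a \<Rightarrow> 'b \<Rightarrow> 'b \<Rightarrow> bool) \<Rightarrow> ('b \<Rightarrow> nat) \<Rightarrow> ('a \<times> 'b) set" where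
  "level_edges E P l = {(a, b) \<in> E.
     (l b = max_level E l a \<and>
        (\<nexists>b'. b' \<in> Nbr E a \<and> l b' = max_level E l a \<and> P a b' b)) \<or>
     (l b + 1 = max_level E l a \<and>
        (\<forall>b' \<in> Nbr E a. l b' = max_level E l a \<longrightarrow> P a b b') \<and>
        (\<nexists>b''. b'' \<in> Nbr E a \<and> l b'' + 1 = max_level E l a \<and> P a b'' b))}"

text \<open>
  The algorithm as a transition system. It is nondeterministic, because any maximum matching
  of \<open>level_edges E P l - F\<close> may be computed in an iteration. A level function is a total
  function on \<^typ>\<open>'b\<close> of which only the values on \<open>B\<close> matter.
\<close>

datatype ('a, 'b) state =
    Running "'b \<Rightarrow> nat"
  | Returned "('a \<times> 'b) set"
  | No_Assignment

definition init_state :: "('a, 'b) state" where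
  "init_state = Running (\<lambda>_. 0)"

inductive step ::
    "'a set \<Rightarrow> 'b set \<Rightarrow> ('a \<times> 'b) set \<Rightarrow> ('a \<Rightarrow> 'b \<Rightarrow> 'b \<Rightarrow> bool) \<Rightarrow> nat \<Rightarrow> ('a \<times> 'b) set \<Rightarrow>
     ('a, 'b) state \<Rightarrow> ('a, 'b) state \<Rightarrow> bool"
  for A B E P n F where
  return:
    "\<lbrakk>\<forall>b\<in>B. l b < n; maximum_matching (level_edges E P l - F) M;
      perfect_matching A B (level_edges E P l - F) M\<rbrakk>
     \<Longrightarrow> step A B E P n F (Running l) (Returned M)"
| raise:
    "\<lbrakk>\<forall>b\<in>B. l b < n; maximum_matching (level_edges E P l - F) M;
      \<not> perfect_matching A B (level_edges E P l - F) M\<rbrakk>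
     \<Longrightarrow> step A B E P n F (Running l)
          (Running (\<lambda>b. if b \<in> B \<and> (\<nexists>a. (a, b) \<in> M) then l b + 1 else l b))"
| report:
    "\<not> (\<forall>b\<in>B. l b < n) \<Longrightarrow> step A B E P n F (Running l) No_Assignment"

text \<open>
  Every run from the initial state is finite, and every state in which a run stops is a
  \<open>Returned M\<close> with \<open>Q M\<close>. In particular no run gets stuck in a \<open>Running\<close> state.
\<close>

definition outputs ::
    "'a set \<Rightarrow> 'b set \<Rightarrow> ('a \<times> 'b) set \<Rightarrow> ('a \<Rightarrow> 'b \<Rightarrow> 'b \<Rightarrow> bool) \<Rightarrow> nat \<Rightarrow> ('a \<times> 'b) set \<Rightarrow>
     (('a \<times> 'b) set \<Rightarrow> bool) \<Rightarrow> bool" where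
  "outputs A B E P n F Q \<longleftrightarrow>
     (\<nexists>\<sigma>. \<sigma> 0 = init_state \<and> (\<forall>i::nat. step A B E P n F (\<sigma> i) (\<sigma> (Suc i)))) \<and>
     (\<forall>s. (step A B E P n F)\<^sup>*\<^sup>* init_state s \<and> (\<nexists>s'. step A B E P n F s s') \<longrightarrow>
        (\<exists>M. s = Returned M \<and> Q M))"

end

theory Submission
  imports Defs
begin

text \<open>
  Let \<open>vote P a b b'\<close> be \<open>1\<close>, \<open>0\<close> or \<open>-1\<close> according to how \<open>a\<close> compares \<open>b\<close> with \<open>b'\<close>. An edge
  \<open>(a, b)\<close> lies in \<open>G\<^sub>l\<close> iff \<open>l b' + vote P a b' b \<le> l b\<close> for every neighbour \<open>b'\<close> of \<open>a\<close>.
  Summed over a perfect matching, these inequalities show that perfect matchings of \<open>G\<^sub>l\<close> are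
  popular. Conversely, if \<open>M\<close> is popular, no alternating cycle has positive total vote, so the
  maximum vote of a simple alternating path is a level function with values below \<open>n\<close> that puts
  \<open>M\<close> into \<open>G\<^sub>l\<close>.

  Fix such a level function \<open>l\<^sup>*\<close> for a popular assignment \<open>M\<^sup>*\<close> avoiding \<open>F\<close>. The
  algorithm maintains \<open>l \<le> l\<^sup>*\<close>: at an object with \<open>l b = l\<^sup>* b\<close>, the alternating path of
  \<open>M\<^sup>*\<close> and \<open>M\<close> starting there stays in \<open>G\<^sub>l - F\<close>, so the object is covered by every maximum
  matching. Since every iteration raises some level, the algorithm stops, and it never reports
  failure.
\<close>

section \<open>Signed votes between two objects\<close>

definition vote :: "('a \<Rightarrow> 'b \<Rightarrow> 'b \<Rightarrow> bool) \<Rightarrow> 'a \<Rightarrow> 'b \<Rightarrow> 'b \<Rightarrow> int" where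
  "vote P a b b' = of_bool (P a b b') - of_bool (P a b' b)"

lemma vote_swap: "vote P a b b' = - vote P a b' b"
  by (simp add: vote_def)

lemma vote_le_1: "vote P a b b' \<le> 1"
  by (simp add: vote_def)

lemma vote_ge_minus_1: "- 1 \<le> vote P a b b'"
  by (simp add: vote_def)

section \<open>Matchings as functions\<close>

lemma partner_eq:
  assumes "matching H M" "(a, b) \<in> M"
  shows "partner M a = b"
  using assms unfolding partner_def matching_def by blast

lemma perfect_matching_eq_graph:
  assumes "perfect_matching A B H M" "H \<subseteq> A \<times> B"
  shows "M = (\<lambda>a. (a, partner M a)) ` A"
proof (intro set_eqI iffI)
  have mat: "matching H M"
    using assms(1) by (simp add: perfect_matching_def)
  fix e
  show "e \<in> (\<lambda>a. (a, partner M a)) ` A" if "e \<in> M"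
  proof -
    have "e = (fst e, partner M (fst e))"
      using partner_eq[OF mat, of "fst e" "snd e"] that by (cases e) simp
    moreover have "fst e \<in> A"
      using that mat assms(2) unfolding matching_def by auto
    ultimately show ?thesis by (rule image_eqI)
  qed
  show "e \<in> M" if "e \<in> (\<lambda>a. (a, partner M a)) ` A"
  proof -
    obtain a where a: "a \<in> A" "e = (a, partner M a)" using \<open>e \<in> _\<close> by (rule imageE)
    then obtain b where "(a, b) \<in> M"
      using assms(1) unfolding perfect_matching_def by blast
    then show ?thesis using a partner_eq[OF mat] by metis
  qed
qed

text \<open>Used to reindex sums: the levels of all partners add up to the total level of
  \<open>B\<close>, whichever perfect matching is taken.\<close>

lemma bij_betw_partner:
  assumes pm: "perfect_matching A B H M" and H: "H \<subseteq> A \<times> B"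
  shows "bij_betw (partner M) A B"
proof -
  have mat: "matching H M"
    using pm by (simp add: perfect_matching_def)
  have mem: "(a, partner M a) \<in> M" if "a \<in> A" for a
    using perfect_matching_eq_graph[OF pm H] that by blast
  have "inj_on (partner M) A"
    using mem mat unfolding inj_on_def matching_def by metis
  moreover have "partner M ` A = B"
  proof (intro equalityI subsetI)
    fix b assume "b \<in> partner M ` A"
    then show "b \<in> B" using mem mat H unfolding matching_def by blast
  next
    fix b assume "b \<in> B"
    then obtain a where "(a, b) \<in> M" using pm unfolding perfect_matching_def by blast
    moreover from this have "a \<in> A" using mat H unfolding matching_def by blast
    ultimately show "b \<in> partner M ` A"
      using partner_eq[OF mat] by blast
  qed
  ultimately show ?thesis by (simp add: bij_betw_def)
qed

lemma perfect_matching_graph: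
  assumes "bij_betw p A B" "\<And>a. a \<in> A \<Longrightarrow> (a, p a) \<in> H"
  shows "perfect_matching A B H ((\<lambda>a. (a, p a)) ` A)"
  using assms unfolding perfect_matching_def matching_def bij_betw_def
  by (auto dest: inj_onD)

lemma partner_graph: "a \<in> A \<Longrightarrow> partner ((\<lambda>a. (a, p a)) ` A) a = p a"
  unfolding partner_def by blast

text \<open>Both matchings cover every agent, so the unmatched clause of
  \<open>prefers_matching\<close> never applies and only comparisons of partners remain.\<close>

lemma Delta_eq_sum_vote:
  assumes "finite A" "perfect_matching A B H M" "perfect_matching A B H N"
  shows "Delta A P M N = (\<Sum>a\<in>A. vote P a (partner M a) (partner N a))"
proof -
  have "{a \<in> A. prefers_matching P a M N} = {a \<in> A. P a (partner M a) (partner N a)}"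
    "{a \<in> A. prefers_matching P a N M} = {a \<in> A. P a (partner N a) (partner M a)}"
    using assms unfolding prefers_matching_def perfect_matching_def by blast+
  then show ?thesis
    using assms(1) unfolding Delta_def vote_def by (simp add: sum_subtractf Int_def)
qed

section \<open>Maximum matchings and a counting criterion for perfection\<close>

lemma finite_maximum_matching_exists:
  assumes "finite H"
  shows "\<exists>M. maximum_matching H M"
proof -
  have "matching H {}" by (simp add: matching_def)
  moreover have "card N < Suc (card H)" if "matching H N" for N
    using that assms card_mono unfolding matching_def by (auto simp: less_Suc_eq_le)
  ultimately obtain M where "matching H M" "\<forall>N. matching H N \<longrightarrow> card N \<le> card M"
    using ex_has_greatest_nat[of "matching H" "{}" card "Suc (card H)"] by auto
  then show ?thesis unfolding maximum_matching_def by blast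
qed

lemma matching_inj_on:
  assumes "matching H M"
  shows "inj_on fst M" and "inj_on snd M"
  using assms unfolding matching_def inj_on_def by auto

text \<open>\<open>fst\<close> and \<open>snd\<close> are injective on \<open>M\<close>, so covering
  \<open>B\<close> uses \<open>card A\<close> distinct agents. Contrapositively, an imperfect
  matching misses some object, so every \<open>raise\<close> step raises a level.\<close>

lemma perfect_matchingI_covers_right:
  assumes "matching H M" "H \<subseteq> A \<times> B" "finite A" "card A = card B"
    and cov: "\<And>b. b \<in> B \<Longrightarrow> \<exists>a. (a, b) \<in> M"
  shows "perfect_matching A B H M"
proof -
  have "M \<subseteq> A \<times> B"
    using assms(1,2) unfolding matching_def by blast
  moreover have "b \<in> snd ` M" if "b \<in> B" for b
    using cov[OF that] by force
  ultimately have "snd ` M = B" "fst ` M \<subseteq> A" by auto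
  moreover have "card (fst ` M) = card (snd ` M)"
    using matching_inj_on[OF assms(1)] by (simp add: card_image)
  ultimately have "fst ` M = A"
    using assms by (metis card_subset_eq)
  then have "\<forall>a\<in>A. \<exists>b. (a, b) \<in> M" by force
  then show ?thesis using assms unfolding perfect_matching_def by blast
qed

section \<open>Weighted paths and cycles\<close>

fun path_weight :: "('v \<Rightarrow> 'v \<Rightarrow> int) \<Rightarrow> 'v list \<Rightarrow> int" where
  "path_weight w (x # y # zs) = w x y + path_weight w (y # zs)"
| "path_weight w _ = 0"

lemma path_weight_append:
  "path_weight w (xs @ y # ys) = path_weight w (xs @ [y]) + path_weight w (y # ys)"
  by (induction xs rule: induct_list012) auto

text \<open>A path on \<open>k\<close> vertices has \<open>k - 1\<close> edges; this off-by-one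
  keeps levels strictly below \<open>n\<close>.\<close>

lemma path_weight_less_length:
  assumes "\<And>x y. w x y \<le> 1" "xs \<noteq> []"
  shows "path_weight w xs < int (length xs)"
  using assms(2)
proof (induction xs rule: induct_list012)
  case (3 x y zs)
  then show ?case using assms(1)[of x y] by simp
qed auto

text \<open>For \<open>y = x\<close> the map \<open>f\<close> rotates a cycle. The endpoint
  \<open>y\<close> is kept general because the tail of a cycle is only a path, which the induction
  needs.\<close>

lemma path_successor_function:
  assumes "distinct (x # xs)" "successively R (x # xs @ [y])"
  shows "\<exists>f. f ` set (x # xs) = insert y (set xs) \<and> (\<forall>v\<in>set (x # xs). R v (f v)) \<and>
    (\<Sum>v\<in>set (x # xs). w v (f v)) = path_weight w (x # xs @ [y])"
  using assms
proof (induction xs arbitrary: x)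
  case Nil
  then show ?case by (intro exI[of _ "\<lambda>_. y"]) auto
next
  case (Cons z zs)
  then obtain f where f: "f ` set (z # zs) = insert y (set zs)"
    "\<forall>v\<in>set (z # zs). R v (f v)"
    "(\<Sum>v\<in>set (z # zs). w v (f v)) = path_weight w (z # zs @ [y])"
    by force
  have x: "x \<notin> set (z # zs)" using Cons.prems by simp
  have agree: "(f(x := z)) v = f v" if "v \<in> set (z # zs)" for v
    using x that by auto
  have "(\<Sum>v\<in>set (z # zs). w v ((f(x := z)) v)) = (\<Sum>v\<in>set (z # zs). w v (f v))"
    by (intro sum.cong refl) (simp only: agree)
  then have "(\<Sum>v\<in>set (x # z # zs). w v ((f(x := z)) v)) = path_weight w (x # (z # zs) @ [y])"
    using f(3) x by simp
  moreover have "(f(x := z)) ` set (z # zs) = f ` set (z # zs)"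
    by (intro image_cong refl agree)
  then have "(f(x := z)) ` set (x # z # zs) = insert y (set (z # zs))"
    using f(1) by (simp del: fun_upd_apply) (simp add: insert_commute)
  moreover have "\<forall>v\<in>set (x # z # zs). R v ((f(x := z)) v)"
    using f(2) Cons.prems agree by auto
  ultimately show ?case by blast
qed

text \<open>Take \<open>h x\<close> to be the largest weight of a simple \<open>R\<close>-path
  starting at \<open>x\<close>. Simplicity makes the maximum finite and bounds it; without positive
  cycles, prepending an edge to a best path never beats it.\<close>

lemma potential_exists:
  fixes V :: "'v set" and w :: "'v \<Rightarrow> 'v \<Rightarrow> int"
  assumes fin: "finite V" and w1: "\<And>x y. w x y \<le> 1"
    and cyc: "\<And>x xs. \<lbrakk>distinct (x # xs); set (x # xs) \<subseteq> V; successively R (x # xs @ [x])\<rbrakk>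
      \<Longrightarrow> path_weight w (x # xs @ [x]) \<le> 0"
  shows "\<exists>h. (\<forall>x\<in>V. h x < card V) \<and> (\<forall>x\<in>V. \<forall>y\<in>V. R x y \<longrightarrow> int (h y) + w x y \<le> int (h x))"
proof -
  define path where "path x p \<longleftrightarrow>
    distinct p \<and> set p \<subseteq> V \<and> successively R p \<and> p \<noteq> [] \<and> hd p = x" for x p
  define best where "best x = Max (path_weight w ` {p. path x p})" for x
  have "{p. path x p} \<subseteq> {p. set p \<subseteq> V \<and> distinct p}" for x
    by (auto simp: path_def)
  then have finp: "finite {p. path x p}" for x
    using finite_subset_distinct[OF fin] finite_subset by blast
  have bound: "path_weight w p \<le> best x" if "path x p" for x p
    using that finp unfolding best_def by simp
  have attained: "\<exists>p. path x p \<and> best x = path_weight w p" if "x \<in> V" for x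
  proof -
    have "path x [x]" using that by (simp add: path_def)
    then have "best x \<in> path_weight w ` {p. path x p}"
      unfolding best_def using finp by (intro Max_in) auto
    then show ?thesis by auto
  qed
  \<comment> \<open>The one-vertex path has weight 0, so converting \<open>best\<close> to
    \<open>nat\<close> at the end loses nothing.\<close>
  have nonneg: "0 \<le> best x" if "x \<in> V" for x
    using bound[of x "[x]"] that by (simp add: path_def)
  have less: "best x < int (card V)" if x: "x \<in> V" for x
  proof -
    obtain p where p: "path x p" "best x = path_weight w p" using attained[OF x] by blast
    have "length p \<le> card V"
      using p(1) fin unfolding path_def by (metis card_mono distinct_card)
    then show ?thesis using path_weight_less_length[of w p] w1 p unfolding path_def by force
  qed
  have step: "best y + w x y \<le> best x" if xy: "x \<in> V" "y \<in> V" "R x y" for x y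
  proof -
    obtain p where p: "path y p" "best y = path_weight w p" using attained[OF xy(2)] by blast
    obtain q where q: "p = y # q" using p(1) unfolding path_def by (cases p) auto
    have sum: "path_weight w (x # p) = w x y + best y" using q p(2) by simp
    have succ: "successively R (x # p)" using p(1) q xy(3) by (simp add: path_def)
    show ?thesis
    proof (cases "x \<in> set p")
      case False
      then have "path x (x # p)" using p(1) xy succ by (simp add: path_def)
      then show ?thesis using bound sum by fastforce
    next
      case True
      \<comment> \<open>The path from \<open>x\<close> via \<open>y\<close> closes a cycle of nonpositive weight, which is cut off.\<close>
      then obtain c d where cd: "p = c @ x # d" by (meson split_list)
      have "path_weight w (x # c @ [x]) \<le> 0"
        using p(1) succ cd xy(1) by (intro cyc)
          (auto simp: path_def successively_append_iff successively_Cons hd_append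
            split: if_splits)
      moreover have "path x (x # d)"
        using p(1) cd by (auto simp: path_def successively_append_iff)
      then have "path_weight w (x # d) \<le> best x" by (rule bound)
      moreover have "path_weight w (x # p) = path_weight w (x # c @ [x]) + path_weight w (x # d)"
        using path_weight_append[of w "x # c" x d] cd by simp
      ultimately show ?thesis using sum by linarith
    qed
  qed
  show ?thesis
    using nonneg less step
    by (intro exI[of _ "\<lambda>x. nat (best x)"]) (simp add: nat_less_iff)
qed

section \<open>Level functions and popular assignments\<close>

locale assignment_instance =
  fixes A :: "'a set" and B :: "'b set" and E :: "('a \<times> 'b) set"
    and P :: "'a \<Rightarrow> 'b \<Rightarrow> 'b \<Rightarrow> bool"
  assumes finite_A: "finite A" and finite_B: "finite B" and card_eq: "card A = card B"
    and E_subset: "E \<subseteq> A \<times> B"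
    and irrefl: "a \<in> A \<Longrightarrow> irreflp_on (Nbr E a) (P a)"
    and trans: "a \<in> A \<Longrightarrow> transp_on (Nbr E a) (P a)"
begin

lemma finite_E: "finite E"
  using finite_subset[OF E_subset] finite_A finite_B by simp

lemma level_edges_subset: "level_edges E P l \<subseteq> E"
  by (auto simp: level_edges_def)

text \<open>Irreflexivity and transitivity give asymmetry, so the opposite indicator
  vanishes.\<close>

lemma vote_eq_1:
  assumes "(a, b) \<in> E" "(a, b') \<in> E" "P a b b'"
  shows "vote P a b b' = 1"
proof -
  have "a \<in> A" using assms E_subset by blast
  then have "\<not> P a b' b"
    using assms irrefl trans unfolding Nbr_def by (auto dest: transp_onD irreflp_onD)
  then show ?thesis using assms by (simp add: vote_def)
qed

text \<open>Turns the two-case definition into linear inequalities that can be summed: a preferred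
  neighbour must lie strictly lower, an incomparable one no higher, a worse one at most one level
  higher.\<close>

lemma level_edges_iff:
  assumes ab: "(a, b) \<in> E"
  shows "(a, b) \<in> level_edges E P l \<longleftrightarrow>
    (\<forall>b'. (a, b') \<in> E \<longrightarrow> int (l b') + vote P a b' b \<le> int (l b))"
proof -
  define m where "m = max_level E l a"
  have "Nbr E a \<subseteq> B" using E_subset by (auto simp: Nbr_def)
  then have fin: "finite (l ` Nbr E a)" using finite_B finite_subset by blast
  have le: "l b' \<le> m" if "(a, b') \<in> E" for b'
    using fin that unfolding m_def max_level_def Nbr_def by simp
  have "m \<in> l ` Nbr E a"
    unfolding m_def max_level_def using fin ab by (intro Max_in) (auto simp: Nbr_def)
  then obtain c where c: "(a, c) \<in> E" "l c = m" by (auto simp: Nbr_def)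
  have edge: "(a, b) \<in> level_edges E P l \<longleftrightarrow>
     (l b = m \<and> (\<forall>b'. (a, b') \<in> E \<longrightarrow> l b' = m \<longrightarrow> \<not> P a b' b)) \<or>
     (l b + 1 = m \<and> (\<forall>b'. (a, b') \<in> E \<longrightarrow> l b' = m \<longrightarrow> P a b b') \<and>
        (\<forall>b'. (a, b') \<in> E \<longrightarrow> l b' + 1 = m \<longrightarrow> \<not> P a b' b))"
    using ab by (auto simp: level_edges_def m_def Nbr_def)
  show ?thesis
  proof
    assume L: "(a, b) \<in> level_edges E P l"
    show "\<forall>b'. (a, b') \<in> E \<longrightarrow> int (l b') + vote P a b' b \<le> int (l b)"
    proof (intro allI impI)
      fix b' assume b': "(a, b') \<in> E"
      consider "P a b b'" | "P a b' b" "\<not> P a b b'" | "\<not> P a b' b" "\<not> P a b b'" by blast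
      then show "int (l b') + vote P a b' b \<le> int (l b)"
      proof cases
        case 1
        then have "vote P a b' b = - 1"
          using vote_eq_1[OF ab b'] vote_swap[of P a b' b] by simp
        then show ?thesis using L edge le[OF b'] by auto
      next
        case 2
        then have "l b' < l b" using L edge le[OF b'] b' by force
        then show ?thesis using vote_le_1[of P a b' b] by linarith
      next
        case 3
        then have "l b' \<le> l b" using L edge le[OF b'] b' by force
        then show ?thesis using 3 by (simp add: vote_def)
      qed
    qed
  next
    assume H: "\<forall>b'. (a, b') \<in> E \<longrightarrow> int (l b') + vote P a b' b \<le> int (l b)"
    have better: "l b' < l b" if "(a, b') \<in> E" "P a b' b" for b'
      using H that(1) vote_eq_1[OF that(1) ab that(2)] by force
    have worse: "P a b b'" if "(a, b') \<in> E" "l b < l b'" for b'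
    proof (rule ccontr)
      assume "\<not> P a b b'"
      then have "0 \<le> vote P a b' b" by (simp add: vote_def)
      then show False using H that by force
    qed
    \<comment> \<open>The inequality at a top-level neighbour \<open>c\<close> leaves only the two
      levels that the definition allows.\<close>
    have "m \<le> l b + 1" using H c vote_ge_minus_1[of P a c b] by force
    then consider "l b = m" | "l b + 1 = m" using le[OF ab] by linarith
    then show "(a, b) \<in> level_edges E P l"
      by cases (use edge better worse in \<open>fastforce+\<close>)
  qed
qed

text \<open>Weak duality: each agent's vote for \<open>M\<close> against \<open>N\<close> is at
  least a difference of levels, and these differences sum to 0 over two perfect matchings.\<close>

lemma perfect_matching_level_edges_popular:
  assumes pm: "perfect_matching A B (level_edges E P l - F) M"
  shows "popular_assignment A B E P M"
proof -
  have sub: "level_edges E P l - F \<subseteq> A \<times> B" using level_edges_subset E_subset by blast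
  have M: "(a, partner M a) \<in> level_edges E P l" if "a \<in> A" for a
  proof -
    have "(a, partner M a) \<in> M" using perfect_matching_eq_graph[OF pm sub] that by blast
    then show ?thesis using pm unfolding perfect_matching_def matching_def by blast
  qed
  have pmE: "perfect_matching A B E M"
    using pm level_edges_subset unfolding perfect_matching_def matching_def by blast
  have "0 \<le> Delta A P M N" if N: "perfect_matching A B E N" for N
  proof -
    have "int (l (partner N a)) - int (l (partner M a)) \<le> vote P a (partner M a) (partner N a)"
      if a: "a \<in> A" for a
    proof -
      have "(a, partner N a) \<in> E"
      proof -
        have "(a, partner N a) \<in> N" using perfect_matching_eq_graph[OF N E_subset] a by blast
        then show ?thesis using N unfolding perfect_matching_def matching_def by blast
      qed
      moreover have "(a, partner M a) \<in> E" using M[OF a] level_edges_subset by blast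
      ultimately have
        "int (l (partner N a)) + vote P a (partner N a) (partner M a) \<le> int (l (partner M a))"
        using M[OF a] level_edges_iff by blast
      then show ?thesis using vote_swap[of P a "partner M a" "partner N a"] by linarith
    qed
    then have "(\<Sum>a\<in>A. int (l (partner N a)) - int (l (partner M a))) \<le> Delta A P M N"
      unfolding Delta_eq_sum_vote[OF finite_A pmE N] by (rule sum_mono)
    moreover have "(\<Sum>a\<in>A. int (l (partner N a))) = (\<Sum>b\<in>B. int (l b))"
      using bij_betw_partner[OF N E_subset] by (rule sum.reindex_bij_betw)
    moreover have "(\<Sum>a\<in>A. int (l (partner M a))) = (\<Sum>b\<in>B. int (l b))"
      using bij_betw_partner[OF pmE E_subset] by (rule sum.reindex_bij_betw)
    ultimately show ?thesis by (simp add: sum_subtractf)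
  qed
  then show ?thesis using pmE unfolding popular_assignment_def by blast
qed

lemma popular_level_function:
  assumes pop: "popular_assignment A B E P M"
  shows "\<exists>l. (\<forall>b\<in>B. l b < card A) \<and> M \<subseteq> level_edges E P l"
proof -
  let ?p = "partner M"
  \<comment> \<open>Objects are represented by their owners in \<open>M\<close>: an edge lets
    \<open>a\<close> take over the partner of \<open>a'\<close>, weighted by her vote for this
    change.\<close>
  define R where "R a a' \<longleftrightarrow> (a, ?p a') \<in> E" for a a'
  define w where "w a a' = vote P a (?p a') (?p a)" for a a'
  have pm: "perfect_matching A B E M" using pop by (simp add: popular_assignment_def)
  note bij = bij_betw_partner[OF pm E_subset]
  note graph = perfect_matching_eq_graph[OF pm E_subset]
  have ME: "M \<subseteq> E" using pm by (simp add: perfect_matching_def matching_def)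
  have cyc: "path_weight w (x # xs @ [x]) \<le> 0"
    if c: "distinct (x # xs)" "set (x # xs) \<subseteq> A" "successively R (x # xs @ [x])" for x xs
  proof -
    let ?C = "set (x # xs)"
    obtain f where f: "f ` ?C = ?C" "\<forall>v\<in>?C. R v (f v)"
      "(\<Sum>v\<in>?C. w v (f v)) = path_weight w (x # xs @ [x])"
      using path_successor_function[OF c(1,3), of w] by auto
    \<comment> \<open>Partners are passed along the cycle and kept elsewhere, which yields a rival
      perfect matching \<open>N\<close> whose lead over \<open>M\<close> is the cycle
      weight.\<close>
    define g where "g a = (if a \<in> ?C then f a else a)" for a
    have "g ` ?C = ?C" using f(1) by (simp add: g_def)
    moreover have "g ` (A - ?C) = A - ?C" by (simp add: g_def)
    moreover have "A = ?C \<union> (A - ?C)" using c(2) by blast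
    ultimately have "g ` A = A" by (metis image_Un)
    then have "bij_betw g A A"
      using finite_A by (simp add: bij_betw_def eq_card_imp_inj_on)
    then have bijN: "bij_betw (?p \<circ> g) A B" using bij by (rule bij_betw_trans)
    define N where "N = (\<lambda>a. (a, (?p \<circ> g) a)) ` A"
    have "(a, (?p \<circ> g) a) \<in> E" if "a \<in> A" for a
      using f(2) that graph ME by (auto simp: g_def R_def)
    then have N: "perfect_matching A B E N"
      unfolding N_def using bijN perfect_matching_graph by blast
    have "- Delta A P M N = (\<Sum>a\<in>A. w a (g a))"
      unfolding Delta_eq_sum_vote[OF finite_A pm N] sum_negf[symmetric]
      by (intro sum.cong refl) (simp add: w_def N_def partner_graph vote_swap[symmetric])
    \<comment> \<open>Off the cycle an agent compares her partner with itself, a vote of 0.\<close>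
    also have "\<dots> = (\<Sum>a\<in>?C. w a (g a))"
      using finite_A c(2) by (intro sum.mono_neutral_right) (auto simp: g_def w_def vote_def)
    also have "\<dots> = path_weight w (x # xs @ [x])"
      unfolding f(3)[symmetric] by (intro sum.cong refl) (simp add: g_def)
    finally show ?thesis using pop N unfolding popular_assignment_def by force
  qed
  have "w a a' \<le> 1" for a a' by (simp add: w_def vote_le_1)
  then have "\<exists>h. (\<forall>a\<in>A. h a < card A) \<and>
      (\<forall>a\<in>A. \<forall>a'\<in>A. R a a' \<longrightarrow> int (h a') + w a a' \<le> int (h a))"
    using finite_A cyc by (intro potential_exists)
  then obtain h where h: "\<And>a. a \<in> A \<Longrightarrow> h a < card A"
    "\<And>a a'. \<lbrakk>a \<in> A; a' \<in> A; R a a'\<rbrakk> \<Longrightarrow> int (h a') + w a a' \<le> int (h a)"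
    by blast
  \<comment> \<open>The owner map carries the potential from agents back to objects.\<close>
  define q where "q = inv_into A ?p"
  have q: "q b \<in> A" "?p (q b) = b" if "b \<in> B" for b
    using bij that unfolding q_def bij_betw_def
    by (auto intro: inv_into_into f_inv_into_f)
  have qp: "q (?p a) = a" if "a \<in> A" for a
    using bij that unfolding q_def bij_betw_def by (simp add: inv_into_f_f)
  have "(a, ?p a) \<in> level_edges E P (h \<circ> q)" if a: "a \<in> A" for a
  proof -
    have E: "(a, ?p a) \<in> E" using graph ME a by blast
    have "int ((h \<circ> q) b) + vote P a b (?p a) \<le> int ((h \<circ> q) (?p a))" if b: "(a, b) \<in> E" for b
    proof -
      have "b \<in> B" using b E_subset by blast
      then show ?thesis using h(2)[OF a, of "q b"] q qp[OF a] b by (simp add: R_def w_def)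
    qed
    then show ?thesis using level_edges_iff[OF E] by blast
  qed
  then have "M \<subseteq> level_edges E P (h \<circ> q)" by (subst graph) blast
  then show ?thesis using h(1) q(1) by (intro exI[of _ "h \<circ> q"]) auto
qed

section \<open>The invariant of the algorithm\<close>

text \<open>Exchange argument on the whole set \<open>R\<close> of objects reachable from an
  uncovered tight \<open>b0\<close>: giving all of \<open>R\<close> to their owners in
  \<open>S\<close> enlarges \<open>M\<close>.\<close>

lemma maximum_matching_covers_tight:
  assumes pm: "perfect_matching A B (level_edges E P l' - F) S"
    and le: "\<And>b. b \<in> B \<Longrightarrow> l b \<le> l' b"
    and max: "maximum_matching (level_edges E P l - F) M"
    and b0: "b0 \<in> B" "l b0 = l' b0"
  shows "\<exists>a. (a, b0) \<in> M"
proof (rule ccontr)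
  assume unmatched: "\<nexists>a. (a, b0) \<in> M"
  have mat: "matching (level_edges E P l - F) M" using max by (simp add: maximum_matching_def)
  have S: "matching (level_edges E P l' - F) S" using pm by (simp add: perfect_matching_def)
  have finM: "finite M" "finite S"
    using mat S level_edges_subset finite_E finite_subset unfolding matching_def
    by (metis Diff_subset)+
  \<comment> \<open>One alternating step: from an object to its \<open>S\<close>-agent, then to her
    object in \<open>M\<close>.\<close>
  define T where "T = {(b, b'). \<exists>a. (a, b) \<in> S \<and> (a, b') \<in> M}"
  define R where "R = {b. (b0, b) \<in> T\<^sup>*}"
  have edge_B: "b \<in> B" if "(a, b) \<in> E" for a b using that E_subset by blast
  have S_edge: "(a, b) \<in> E" "(a, b) \<in> level_edges E P l'" "(a, b) \<notin> F" if "(a, b) \<in> S" for a b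
    using S that level_edges_subset unfolding matching_def by blast+
  have M_edge: "(a, b) \<in> E" "(a, b) \<in> level_edges E P l" if "(a, b) \<in> M" for a b
    using mat that level_edges_subset unfolding matching_def by blast+
  \<comment> \<open>Passing from \<open>l'\<close> to \<open>l\<close> fixes the right side of the
    edge inequality and can only lower the left side.\<close>
  have S_level: "(a, b) \<in> level_edges E P l" if ab: "(a, b) \<in> S" "l b = l' b" for a b
  proof -
    have "int (l b') + vote P a b' b \<le> int (l b)" if "(a, b') \<in> E" for b'
      using that S_edge[OF ab(1)] level_edges_iff[of a b l'] le[OF edge_B[OF that]] ab(2) by force
    then show ?thesis using level_edges_iff S_edge(1)[OF ab(1)] by blast
  qed
  \<comment> \<open>Two edges of \<open>G\<^sub>l\<close> at the same agent differ in level by exactly the vote between them.\<close>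
  have T_tight: "l c = l' c \<and> c \<in> B" if bc: "(b, c) \<in> T" "l b = l' b" for b c
  proof -
    obtain a where a: "(a, b) \<in> S" "(a, c) \<in> M" using bc(1) unfolding T_def by blast
    have "int (l b) + vote P a b c \<le> int (l c)"
      using level_edges_iff M_edge[OF a(2)] S_edge(1)[OF a(1)] by blast
    moreover have "int (l' c) + vote P a c b \<le> int (l' b)"
      using level_edges_iff[of a b l'] M_edge[OF a(2)] S_edge[OF a(1)] by blast
    moreover have "c \<in> B" using edge_B M_edge[OF a(2)] by blast
    ultimately show ?thesis using le[of c] vote_swap[of P a b c] bc(2) by force
  qed
  have R_tight: "l b = l' b \<and> b \<in> B" if "b \<in> R" for b
  proof -
    have "(b0, b) \<in> T\<^sup>*" using that by (simp add: R_def)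
    then show ?thesis by induction (use b0 T_tight in auto)
  qed
  have R_closed: "b' \<in> R" if "b \<in> R" "(a, b) \<in> S" "(a, b') \<in> M" for a b b'
    using that unfolding R_def T_def by (auto intro: rtrancl_into_rtrancl)
  \<comment> \<open>\<open>M\<close> reaches \<open>R\<close> only through agents whose
    \<open>S\<close>-partner is in \<open>R\<close>, so dropping their \<open>M\<close>-edges frees
    all of \<open>R\<close>.\<close>
  have R_pred: "\<exists>c\<in>R. (a, c) \<in> S" if "b \<in> R" "(a, b) \<in> M" for a b
  proof -
    have "b \<noteq> b0" using unmatched that(2) by blast
    moreover have "(b0, b) \<in> T\<^sup>*" using that(1) by (simp add: R_def)
    ultimately obtain c where c: "c \<in> R" "(c, b) \<in> T"
      unfolding R_def by (auto elim: rtranclE)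
    then obtain a' where "(a', c) \<in> S" "(a', b) \<in> M" unfolding T_def by blast
    then show ?thesis using c(1) that(2) mat unfolding matching_def by blast
  qed
  define SR where "SR = {e \<in> S. snd e \<in> R}"
  define MR where "MR = {e \<in> M. fst e \<in> fst ` SR}"
  have SR_iff: "(a, b) \<in> SR \<longleftrightarrow> (a, b) \<in> S \<and> b \<in> R" for a b by (auto simp: SR_def)
  have MR_iff: "(a, b) \<in> MR \<longleftrightarrow> (a, b) \<in> M \<and> (\<exists>c\<in>R. (a, c) \<in> S)" for a b
    by (force simp: MR_def SR_def)
  have "snd ` SR = R"
  proof
    show "R \<subseteq> snd ` SR"
    proof
      fix b assume b: "b \<in> R"
      then obtain a where "(a, b) \<in> S" using R_tight pm unfolding perfect_matching_def by blast
      then show "b \<in> snd ` SR" using b by (force simp: SR_def)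
    qed
  qed (auto simp: SR_def)
  moreover have injSR: "inj_on snd SR"
    by (rule inj_on_subset[OF matching_inj_on(2)[OF S]]) (auto simp: SR_def)
  ultimately have cardSR: "card SR = card R" by (metis card_image)
  have "inj_on snd MR"
    by (rule inj_on_subset[OF matching_inj_on(2)[OF mat]]) (auto simp: MR_def)
  moreover have "snd ` MR \<subseteq> R - {b0}"
    using R_closed unmatched by (auto simp: MR_iff)
  moreover have "finite R" using R_tight finite_B finite_subset by (metis subsetI)
  moreover have "b0 \<in> R" by (simp add: R_def)
  \<comment> \<open>The removed edges miss \<open>b0\<close>, while the inserted ones cover all of
    \<open>R\<close>.\<close>
  ultimately have "card MR < card SR"
    unfolding cardSR by (metis card_Diff1_less card_image card_mono finite_Diff le_less_trans)
  moreover define M' where "M' = (M - MR) \<union> SR"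
  moreover have "(M - MR) \<inter> SR = {}"
    using R_pred by (auto simp: MR_iff SR_iff)
  then have "card M' = card (M - MR) + card SR"
    unfolding M'_def using finM by (intro card_Un_disjoint) (auto simp: SR_def)
  moreover have "MR \<subseteq> M" by (auto simp: MR_def)
  then have "card (M - MR) + card MR = card M"
    using finM(1) by (metis card_Diff_subset card_mono finite_subset le_add_diff_inverse2)
  ultimately have "card M < card M'" by linarith
  moreover have "matching (level_edges E P l - F) M'"
    unfolding matching_def
  proof (intro conjI allI impI)
    have "SR \<subseteq> level_edges E P l - F"
      using S_level R_tight S_edge(3) by (auto simp: SR_iff)
    then show "M' \<subseteq> level_edges E P l - F"
      using mat unfolding M'_def matching_def by blast
  next
    fix a b b' assume "(a, b) \<in> M'" "(a, b') \<in> M'"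
    then show "b = b'"
      using mat S unfolding M'_def matching_def by (auto simp: MR_iff SR_iff)
  next
    fix a a' b assume "(a, b) \<in> M'" "(a', b) \<in> M'"
    then show "a = a'"
      using mat S unfolding M'_def matching_def
      by (auto simp: MR_iff SR_iff dest: R_pred)
  qed
  ultimately show False using max unfolding maximum_matching_def by force
qed

section \<open>Correctness and termination of all runs\<close>

lemma outputs_popular_assignment:
  assumes n: "n = card A"
    and ex: "popular_assignment A B E P S" "S \<inter> F = {}"
  shows "outputs A B E P n F (\<lambda>M. popular_assignment A B E P M \<and> M \<inter> F = {})"
proof -
  obtain l' where l': "\<And>b. b \<in> B \<Longrightarrow> l' b < n" "S \<subseteq> level_edges E P l'"
    using popular_level_function[OF ex(1)] n by blast
  have S: "perfect_matching A B (level_edges E P l' - F) S"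
  proof -
    have "perfect_matching A B E S" using ex(1) by (simp add: popular_assignment_def)
    moreover have "S \<subseteq> level_edges E P l' - F" using ex(2) l'(2) by blast
    ultimately show ?thesis unfolding perfect_matching_def matching_def by simp
  qed
  define inv where "inv s \<longleftrightarrow> (case s of
      Running l \<Rightarrow> \<forall>b\<in>B. l b \<le> l' b
    | Returned M \<Rightarrow> popular_assignment A B E P M \<and> M \<inter> F = {}
    | No_Assignment \<Rightarrow> False)" for s :: "('a, 'b) state"
  have inv_step: "inv s'" if "step A B E P n F s s'" "inv s" for s s'
    using that
  proof cases
    case (return l M)
    then have "M \<inter> F = {}" unfolding perfect_matching_def matching_def by blast
    then show ?thesis
      using return perfect_matching_level_edges_popular by (auto simp: inv_def)
  next
    case (raise l M)
    have le: "l b \<le> l' b" if "b \<in> B" for b using raise \<open>inv s\<close> that by (simp add: inv_def)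
    \<comment> \<open>An unmatched object is not tight, so raising it by one stays below the bound
      \<open>l'\<close>.\<close>
    have "l b < l' b" if "b \<in> B" "\<nexists>a. (a, b) \<in> M" for b
      using maximum_matching_covers_tight[OF S le raise(4) that(1)] le[OF that(1)] that(2)
      by force
    then show ?thesis using raise(2) le by (auto simp: inv_def Suc_le_eq)
  next
    case (report l)
    \<comment> \<open>A level of at least \<open>n\<close> would exceed the bound \<open>l'\<close>,
      whose values on \<open>B\<close> are below \<open>n\<close>.\<close>
    then show ?thesis using \<open>inv s\<close> l'(1) by (force simp: inv_def)
  qed
  have inv_init: "inv init_state" by (simp add: inv_def init_state_def)
  have progress: "\<exists>s'. step A B E P n F (Running l) s'" for l
  proof (cases "\<forall>b\<in>B. l b < n")
    case True
    have "finite (level_edges E P l - F)"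
      using finite_E level_edges_subset finite_subset by (metis finite_Diff)
    then obtain M where "maximum_matching (level_edges E P l - F) M"
      using finite_maximum_matching_exists by blast
    then show ?thesis using True by (meson step.return step.raise)
  qed (meson step.report)
  have sum_step: "sum l B < sum m B" if "step A B E P n F (Running l) (Running m)" for l m
    using that
  proof cases
    case (raise M)
    have sub: "level_edges E P l - F \<subseteq> A \<times> B" using level_edges_subset E_subset by blast
    have "matching (level_edges E P l - F) M"
      using raise by (simp add: maximum_matching_def)
    then obtain b where "b \<in> B" "\<nexists>a. (a, b) \<in> M"
      using raise perfect_matchingI_covers_right[OF _ sub finite_A card_eq] by blast
    then have "\<exists>b\<in>B. l b < m b" using raise by auto
    moreover have "\<forall>b\<in>B. l b \<le> m b" using raise by auto
    ultimately show ?thesis using finite_B by (intro sum_strict_mono_ex1)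
  qed
  have "\<nexists>\<sigma>. \<sigma> 0 = init_state \<and> (\<forall>i::nat. step A B E P n F (\<sigma> i) (\<sigma> (Suc i)))"
  proof
    assume "\<exists>\<sigma>. \<sigma> 0 = init_state \<and> (\<forall>i::nat. step A B E P n F (\<sigma> i) (\<sigma> (Suc i)))"
    then obtain \<sigma> where \<sigma>: "\<sigma> 0 = init_state"
      "\<And>i::nat. step A B E P n F (\<sigma> i) (\<sigma> (Suc i))" by blast
    have inv: "inv (\<sigma> i)" for i
      by (induction i) (use \<sigma> inv_init inv_step in auto)
    \<comment> \<open>Only \<open>Running\<close> states have successors, so an infinite run never
      leaves them.\<close>
    have running: "\<exists>l. \<sigma> i = Running l" for i
      using \<sigma>(2)[of i] by cases auto
    have large: "\<exists>l. \<sigma> i = Running l \<and> i \<le> sum l B" for i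
    proof (induction i)
      case 0
      then show ?case using running by blast
    next
      case (Suc i)
      then obtain l m where "\<sigma> i = Running l" "i \<le> sum l B" "\<sigma> (Suc i) = Running m"
        using running by blast
      then show ?case using sum_step[of l m] \<sigma>(2)[of i] by auto
    qed
    \<comment> \<open>The level sum grows by at least 1 per step but never exceeds
      \<open>sum l' B\<close>; this index is the first that overshoots.\<close>
    obtain l where l: "\<sigma> (Suc (sum l' B)) = Running l" "Suc (sum l' B) \<le> sum l B"
      using large by blast
    have "sum l B \<le> sum l' B"
      using inv[of "Suc (sum l' B)"] l(1) by (intro sum_mono) (simp add: inv_def)
    then show False using l(2) by simp
  qed
  moreover have "\<exists>M. s = Returned M \<and> popular_assignment A B E P M \<and> M \<inter> F = {}"
    if "(step A B E P n F)\<^sup>*\<^sup>* init_state s" "\<nexists>s'. step A B E P n F s s'" for s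
  proof -
    have "inv s" using that(1) by induction (use inv_init inv_step in auto)
    then show ?thesis using that(2) progress by (cases s) (auto simp: inv_def)
  qed
  ultimately show ?thesis unfolding outputs_def by blast
qed

end

theorem theorem12:
  fixes A :: "'a set" and B :: "'b set" and E F :: "('a \<times> 'b) set"
    and P :: "'a \<Rightarrow> 'b \<Rightarrow> 'b \<Rightarrow> bool" and n :: nat
  assumes "finite A" and "finite B" and "card A = n" and "card B = n"
    and "E \<subseteq> A \<times> B" and "F \<subseteq> E"
    and "\<And>a. a \<in> A \<Longrightarrow> irreflp_on (Nbr E a) (P a)"
    and "\<And>a. a \<in> A \<Longrightarrow> transp_on (Nbr E a) (P a)"
    and "\<exists>M. popular_assignment A B E P M \<and> M \<inter> F = {}"
  shows "outputs A B E P n F (\<lambda>M. popular_assignment A B E P M \<and> M \<inter> F = {})"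
proof -
  interpret assignment_instance A B E P
    using assms by unfold_locales auto
  show ?thesis using outputs_popular_assignment assms by blast
qed

end
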